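(* Let $t_0<T<+\infty$ and let $a,b,c,d$ be real-valued continuous functions on $[t_0,T]$. Assume that $a(t)<0$ almost everywhere on $[t_0,T]$, that $\frac{b^2(t)}{a(t)}$ is integrable on $[t_0,T]$, that $$\int_{t_0}^{t}\exp\Big\{\int_{t_0}^{\tau}\Big[c(s)-\frac{b^2(s)}{a(s)}\Big]ds\Big\}d(\tau)\,d\tau\le0,\qquad t\in[t_0,T],$$ and that the differential inequality $$\eta'+a(t)\eta^3+b(t)\eta^2+c(t)\eta+d(t)\ge0$$ has a solution $\eta(t)$ on $[t_0,T]$ such that $\eta(t_0)\ge\eta(T)>0$. Then the equation $$y'+a(t)y^3+b(t)y^2+c(t)y+d(t)=0$$ has a nonnegative closed solution on $[t_0,T]$.
   Context: A solution $y(t)$ of the equation, existing on an interval $[t_0,T]$, is called closed on $[t_0,T]$ if $y(t_0)=y(T)$. A solution of a differential equation or inequality on an interval is a real-valued differentiable function satisfying it at every point of the interval (one-sided derivatives at the endpoints). "Integrable" means Lebesgue integrable. In the integral condition, $d(\tau)$ is the value of the coefficient function $d$ and $d\tau$ is the differential. *)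

theory Defs
  imports "HOL-Analysis.Analysis"
begin

(* Derivatives are taken within the interval, hence one-sided at the endpoints; values of the
   functions outside the interval are irrelevant. *)
definition abel_eq_solution_on ::
  "(real \<Rightarrow> real) \<Rightarrow> (real \<Rightarrow> real) \<Rightarrow> (real \<Rightarrow> real) \<Rightarrow> (real \<Rightarrow> real) \<Rightarrow> real set \<Rightarrow> (real \<Rightarrow> real) \<Rightarrow> bool"
  where "abel_eq_solution_on a b c d I y \<longleftrightarrow>
    (\<forall>t\<in>I. \<exists>y'. (y has_real_derivative y') (at t within I) \<and>
       y' + a t * y t ^ 3 + b t * y t ^ 2 + c t * y t + d t = 0)"

definition abel_ineq_solution_on ::
  "(real \<Rightarrow> real) \<Rightarrow> (real \<Rightarrow> real) \<Rightarrow> (real \<Rightarrow> real) \<Rightarrow> (real \<Rightarrow> real) \<Rightarrow> real set \<Rightarrow> (real \<Rightarrow> real) \<Rightarrow> bool"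
  where "abel_ineq_solution_on a b c d I \<eta> \<longleftrightarrow>
    (\<forall>t\<in>I. \<exists>\<eta>'. (\<eta> has_real_derivative \<eta>') (at t within I) \<and>
       \<eta>' + a t * \<eta> t ^ 3 + b t * \<eta> t ^ 2 + c t * \<eta> t + d t \<ge> 0)"

definition abel_closed_solution_on ::
  "(real \<Rightarrow> real) \<Rightarrow> (real \<Rightarrow> real) \<Rightarrow> (real \<Rightarrow> real) \<Rightarrow> (real \<Rightarrow> real) \<Rightarrow> real \<Rightarrow> real \<Rightarrow> (real \<Rightarrow> real) \<Rightarrow> bool"
  where "abel_closed_solution_on a b c d t0 T y \<longleftrightarrow>
    abel_eq_solution_on a b c d {t0..T} y \<and> y t0 = y T"

end

theory Submission
  imports Defs
begin

text \<open>
  The closed solution is a fixed point of the Poincare map \<open>s \<mapsto> y(T)\<close>, where \<open>y\<close> is the solution with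
  \<open>y(t0) = s\<close>. It suffices to show that this map is defined and continuous on \<open>[0, \<eta>(T)]\<close> and sends
  this interval to itself; the intermediate value theorem then applies. The solutions are kept between
  two barriers.

  The upper barrier is \<open>\<eta>\<close>. It is a supersolution, so \<open>s \<le> \<eta>(T) \<le> \<eta>(t0)\<close> gives
  \<open>y \<le> \<eta>\<close> on the whole interval (\<open>supersolution_comparison\<close>), in particular \<open>y(T) \<le> \<eta>(T)\<close>.

  The lower barrier is \<open>0\<close>. Put \<open>g = c - b\<^sup>2/a\<close> and let \<open>E\<close> be the exponential of the integral of \<open>g\<close>.
  Formally, as long as \<open>y \<ge> 0\<close>,
  \<open>(E y)' = E (y (- a y\<^sup>2 - b y - b\<^sup>2/a) - d) \<ge> - E d\<close>,
  because the quadratic form \<open>(a y)\<^sup>2 + (a y) b + b\<^sup>2\<close> is nonnegative and \<open>a\<close> is negative. Integrating,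
  \<open>E y\<close> at any time is at least \<open>s\<close> minus the integral of \<open>E d\<close>, hence at least \<open>s\<close> by the integral
  condition. So a solution that starts at \<open>s > 0\<close> cannot reach \<open>0\<close>, and \<open>s = 0\<close> follows by continuous
  dependence. Since \<open>a\<close> may vanish on a null set, \<open>g\<close> is only integrable and \<open>E\<close> need not be
  differentiable; \<open>weighted_lower_bound\<close> therefore performs the computation with \<open>a\<close> replaced by
  \<open>a - \<epsilon>\<close> and passes to the limit by dominated convergence.

  The cubic right-hand side is not globally Lipschitz, so solutions are first constructed for the
  equation whose unknown is truncated to \<open>[- N, N]\<close>, with \<open>N\<close> a bound for \<open>\<bar>\<eta>\<bar>\<close>. The
  barriers keep the relevant solutions in the region where the truncation has no effect.
\<close>

section \<open>Initial value problems with a globally Lipschitz right-hand side\<close>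

text \<open>
  The Picard operator is written in the unknown \<open>z(t) = exp (- K t) y(t)\<close>. For \<open>K > L\<close> this
  weight makes it a contraction, with constant \<open>L / K\<close>, on the whole interval at once, so that no
  gluing of local solutions is needed. Functions on the interval become bounded continuous functions on the line by
  composition with the retraction \<open>p\<close>.
\<close>


lemma lipschitz_ivp_exists:
  fixes F :: "real \<Rightarrow> real \<Rightarrow> real"
  assumes le: "t0 \<le> T"
    and cont: "continuous_on ({t0..T} \<times> UNIV) (\<lambda>(t, x). F t x)"
    and lip: "\<And>t x y. t \<in> {t0..T} \<Longrightarrow> \<bar>F t x - F t y\<bar> \<le> L * \<bar>x - y\<bar>"
    and "L \<ge> 0"
  shows "\<exists>y. y t0 = y0 \<and>
    (\<forall>t\<in>{t0..T}. (y has_real_derivative F t (y t)) (at t within {t0..T}))"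
proof -
  define K where "K = L + 1"
  have K: "K > 0" "L / K < 1" "L / K \<ge> 0" using \<open>L \<ge> 0\<close> by (auto simp: K_def)
  define p where "p t = max t0 (min T t)" for t
  have p: "p t \<in> {t0..T}" for t using le by (auto simp: p_def)
  have p_id: "p t = t" if "t \<in> {t0..T}" for t using that by (auto simp: p_def)
  have p_cont: "continuous_on UNIV p" unfolding p_def by (intro continuous_intros)
  define G where "G z s = F s (exp (K * s) * apply_bcontfun z s)" for z :: "real \<Rightarrow>\<^sub>C real" and s
  have G_cont: "continuous_on {t0..T} (G z)" for z
  proof -
    have "continuous_on {t0..T} (\<lambda>s. (\<lambda>(t, x). F t x) (s, exp (K * s) * apply_bcontfun z s))"
      by (rule continuous_on_compose2[OF cont])
         (auto intro!: continuous_intros simp: p)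
    then show ?thesis by (simp add: G_def[abs_def])
  qed
  have G_int: "G z integrable_on {t0..t}" if "t \<in> {t0..T}" for z t
    by (rule integrable_continuous_real)
       (rule continuous_on_subset[OF G_cont], use that in auto)
  define H where "H z t = exp (- K * p t) * (y0 + integral {t0..p t} (G z))" for z t
  have H_cont: "continuous_on UNIV (H z)" for z
  proof -
    have "continuous_on {t0..T} (\<lambda>t. integral {t0..t} (G z))"
      by (intro indefinite_integral_continuous_1 integrable_continuous_real G_cont)
    then have "continuous_on UNIV (\<lambda>t. integral {t0..p t} (G z))"
      by (rule continuous_on_compose2[OF _ p_cont]) (use p in auto)
    then show ?thesis unfolding H_def
      by (intro continuous_intros p_cont)
  qed
  have H_bcont: "H z \<in> bcontfun" for z
  proof -
    have "H z t = H z (p t)" for t by (simp add: H_def p_id[OF p])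
    then have "range (H z) \<subseteq> H z ` {t0..T}" using p by blast
    moreover have "bounded (H z ` {t0..T})"
      by (intro compact_imp_bounded compact_continuous_image continuous_on_subset[OF H_cont]) auto
    ultimately show ?thesis
      using H_cont bounded_subset by (auto simp: bcontfun_def)
  qed
  define \<Phi> where "\<Phi> z = Bcontfun (H z)" for z
  have \<Phi>: "apply_bcontfun (\<Phi> z) = H z" for z
    unfolding \<Phi>_def by (rule Bcontfun_inverse[OF H_bcont])
  have "dist (\<Phi> z) (\<Phi> w) \<le> L / K * dist z w" for z w
  proof (rule dist_bound)
    fix t
    let ?u = "p t" and ?\<delta> = "dist z w"
    have u: "?u \<in> {t0..T}" by (rule p)
    have prim: "((\<lambda>s. L * ?\<delta> * exp (K * s)) has_integral
        (L * ?\<delta> / K * exp (K * ?u) - L * ?\<delta> / K * exp (K * t0))) {t0..?u}"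
      using u K
      by (intro fundamental_theorem_of_calculus)
         (auto intro!: derivative_eq_intros simp flip: has_real_derivative_iff_has_vector_derivative)
    have "norm (integral {t0..?u} (\<lambda>s. G z s - G w s)) \<le> integral {t0..?u} (\<lambda>s. L * ?\<delta> * exp (K * s))"
    proof (rule integral_norm_bound_integral)
      fix s assume s: "s \<in> {t0..?u}"
      have "\<bar>G z s - G w s\<bar> \<le> L * \<bar>exp (K * s) * z s - exp (K * s) * w s\<bar>"
        unfolding G_def by (rule lip) (use s u in auto)
      also have "\<dots> = L * exp (K * s) * dist (z s) (w s)"
        by (simp add: dist_real_def abs_mult flip: right_diff_distrib)
      also have "\<dots> \<le> L * exp (K * s) * ?\<delta>"
        by (intro mult_left_mono dist_bounded) (use \<open>L \<ge> 0\<close> in auto)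
      finally show "norm (G z s - G w s) \<le> L * ?\<delta> * exp (K * s)" by (simp add: mult_ac)
    qed (use u prim in \<open>auto intro!: integrable_diff G_int\<close>)
    also have "\<dots> \<le> L * ?\<delta> / K * exp (K * ?u)"
      using integral_unique[OF prim] \<open>L \<ge> 0\<close> K by simp
    finally have I: "\<bar>integral {t0..?u} (G z) - integral {t0..?u} (G w)\<bar> \<le> L * ?\<delta> / K * exp (K * ?u)"
      using G_int[OF u] by (simp add: integral_diff)
    have "dist (H z t) (H w t)
        = exp (- K * ?u) * \<bar>integral {t0..?u} (G z) - integral {t0..?u} (G w)\<bar>"
      by (simp add: H_def dist_real_def abs_mult flip: right_diff_distrib)
    also have "\<dots> \<le> exp (- K * ?u) * (L * ?\<delta> / K * exp (K * ?u))"
      by (intro mult_left_mono I) simp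
    also have "\<dots> = L / K * ?\<delta>" by (simp add: exp_minus field_simps)
    finally show "dist (\<Phi> z t) (\<Phi> w t) \<le> L / K * ?\<delta>" by (simp add: \<Phi>)
  qed
  then obtain z where z: "\<Phi> z = z"
    using banach_fix_type[of "L / K" \<Phi>] K by blast
  define y where "y t = y0 + integral {t0..t} (G z)" for t
  have y: "y t = exp (K * t) * z t" if "t \<in> {t0..T}" for t
  proof -
    have "z t = exp (- K * t) * y t"
      using fun_cong[OF \<Phi>[of z], of t] z that by (simp add: H_def p_id y_def)
    then show ?thesis by (simp add: exp_minus)
  qed
  have "(y has_real_derivative F t (y t)) (at t within {t0..T})" if t: "t \<in> {t0..T}" for t
  proof -
    have "((\<lambda>u. integral {t0..u} (G z)) has_real_derivative G z t) (at t within {t0..T})"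
      using G_cont t by (rule integral_has_real_derivative)
    then have "(y has_real_derivative G z t) (at t within {t0..T})"
      unfolding y_def by (auto intro!: derivative_eq_intros)
    then show ?thesis by (simp add: G_def y[OF t])
  qed
  moreover have "y t0 = y0" by (simp add: y_def)
  ultimately show ?thesis by blast
qed



text \<open>
  After the last time \<open>s\<close> before \<open>t1\<close> at which \<open>y \<le> \<eta>\<close>, the one-sided Lipschitz bound makes
  \<open>exp (- L t) (y - \<eta>)\<close> nonincreasing, so this difference cannot become positive.
\<close>
lemma supersolution_comparison:
  fixes F :: "real \<Rightarrow> real \<Rightarrow> real"
  assumes lip: "\<And>t x y. t \<in> {t0..T} \<Longrightarrow> y \<le> x \<Longrightarrow> F t x - F t y \<le> L * (x - y)"
    and y: "\<And>t. t \<in> {t0..T} \<Longrightarrow> (y has_real_derivative F t (y t)) (at t within {t0..T})"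
    and \<eta>: "\<And>t. t \<in> {t0..T} \<Longrightarrow>
      \<exists>e. (\<eta> has_real_derivative e) (at t within {t0..T}) \<and> F t (\<eta> t) \<le> e"
    and init: "y t0 \<le> \<eta> t0" and t1: "t1 \<in> {t0..T}"
  shows "y t1 \<le> \<eta> t1"
proof (rule ccontr)
  assume "\<not> y t1 \<le> \<eta> t1"
  have cy: "continuous_on {t0..T} y"
    by (rule DERIV_continuous_on[OF y])
  have c\<eta>: "continuous_on {t0..T} \<eta>"
    unfolding continuous_on_eq_continuous_within using \<eta> DERIV_continuous by blast
  let ?S = "{t \<in> {t0..t1}. y t \<le> \<eta> t}"
  have "closed ?S"
    by (intro continuous_on_closed_Collect_le continuous_on_subset[OF cy] continuous_on_subset[OF c\<eta>])
       (use t1 in auto)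
  then have "compact ?S"
    by (auto simp: compact_eq_bounded_closed intro: bounded_subset[of "{t0..t1}"])
  then obtain s where s: "s \<in> ?S" and max: "\<And>t. t \<in> ?S \<Longrightarrow> t \<le> s"
    using compact_attains_sup[of ?S] init t1 by auto
  define h where "h t = exp (- L * t) * (y t - \<eta> t)" for t
  have "h t1 \<le> h s"
  proof (rule DERIV_nonpos_imp_decreasing_open[where f = h])
    show "continuous_on {s..t1} h"
      unfolding h_def using s t1
      by (intro continuous_intros continuous_on_subset[OF cy] continuous_on_subset[OF c\<eta>]) auto
  next
    fix t assume t: "s < t" "t < t1"
    then have tI: "t \<in> {t0..T}" and at: "at t within {t0..T} = at t"
      using s t1 by (auto intro!: at_within_Icc_at)
    obtain e where e: "(\<eta> has_real_derivative e) (at t)" "F t (\<eta> t) \<le> e"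
      using \<eta>[OF tI] at by auto
    have above: "\<eta> t \<le> y t" using max[of t] t s by force
    have "(h has_real_derivative exp (- L * t) * (F t (y t) - e - L * (y t - \<eta> t))) (at t)"
      unfolding h_def using y[OF tI] e at
      by (auto intro!: derivative_eq_intros simp: algebra_simps)
    moreover have "exp (- L * t) * (F t (y t) - e - L * (y t - \<eta> t)) \<le> 0"
      using lip[OF tI above] e by (intro mult_nonneg_nonpos) auto
    ultimately show "\<exists>h'. (h has_real_derivative h') (at t) \<and> h' \<le> 0" by blast
  qed (use s in auto)
  also have "h s \<le> 0" using s by (auto simp: h_def intro!: mult_nonneg_nonpos)
  finally show False using \<open>\<not> y t1 \<le> \<eta> t1\<close> by (auto simp: h_def mult_le_0_iff)
qed

text \<open>
  Adding \<open>\<delta> exp (L (t - t0))\<close> with \<open>\<delta> \<ge> 0\<close> to a solution gives a supersolution, so this is an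
  instance of the comparison principle.
\<close>
lemma lipschitz_dependence_on_initial_value:
  fixes F :: "real \<Rightarrow> real \<Rightarrow> real"
  assumes lip: "\<And>t x y. t \<in> {t0..T} \<Longrightarrow> y \<le> x \<Longrightarrow> F t x - F t y \<le> L * (x - y)"
    and y: "\<And>t. t \<in> {t0..T} \<Longrightarrow> (y has_real_derivative F t (y t)) (at t within {t0..T})"
    and z: "\<And>t. t \<in> {t0..T} \<Longrightarrow> (z has_real_derivative F t (z t)) (at t within {t0..T})"
    and t: "t \<in> {t0..T}"
  shows "\<bar>y t - z t\<bar> \<le> exp (L * (t - t0)) * \<bar>y t0 - z t0\<bar>"
proof -
  have upper: "u t \<le> v t + exp (L * (t - t0)) * \<bar>y t0 - z t0\<bar>"
    if u: "\<And>t. t \<in> {t0..T} \<Longrightarrow> (u has_real_derivative F t (u t)) (at t within {t0..T})"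
    and v: "\<And>t. t \<in> {t0..T} \<Longrightarrow> (v has_real_derivative F t (v t)) (at t within {t0..T})"
    and init: "u t0 - v t0 \<le> \<bar>y t0 - z t0\<bar>" for u v
  proof (rule supersolution_comparison[where F = F and L = L and y = u and
        \<eta> = "\<lambda>t. v t + exp (L * (t - t0)) * \<bar>y t0 - z t0\<bar>", OF lip u _ _ t])
    fix s assume s: "s \<in> {t0..T}"
    let ?x = "exp (L * (s - t0)) * \<bar>y t0 - z t0\<bar>"
    have "((\<lambda>t. v t + exp (L * (t - t0)) * \<bar>y t0 - z t0\<bar>) has_real_derivative F s (v s) + L * ?x)
        (at s within {t0..T})"
      using v[OF s] by (auto intro!: derivative_eq_intros)
    moreover have "F s (v s + ?x) \<le> F s (v s) + L * ?x"
      using lip[OF s, of "v s" "v s + ?x"] by simp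
    ultimately show "\<exists>e. ((\<lambda>t. v t + exp (L * (t - t0)) * \<bar>y t0 - z t0\<bar>) has_real_derivative e)
        (at s within {t0..T}) \<and> F s (v s + ?x) \<le> e" by blast
  qed (use init in auto)
  show ?thesis using upper[OF y z] upper[OF z y] by fastforce
qed

section \<open>The lower barrier\<close>

text \<open>
  The integrated form of \<open>(E y)' \<ge> - E d\<close>. With \<open>a\<close> replaced by \<open>a - \<epsilon>\<close>, where \<open>\<epsilon> > 0\<close>, in the
  exponent, the weight is continuously differentiable and the inequality holds up to the error \<open>\<epsilon> y\<^sup>3\<close>,
  which is at most \<open>\<epsilon> N\<^sup>3\<close> for a bound \<open>N\<close> of \<open>y\<close>. Since
  \<open>b\<^sup>2 / \<bar>a - \<epsilon>\<bar> \<le> b\<^sup>2 / \<bar>a\<bar>\<close> almost everywhere, \<open>\<bar>c\<bar> + \<bar>b\<^sup>2 / a\<bar>\<close> dominates all regularised exponents,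
  and the limit \<open>\<epsilon> \<rightarrow> 0\<close> can be taken both in the exponent and in the outer integral.
\<close>
lemma weighted_lower_bound:
  fixes t0 T :: real and a b c d y :: "real \<Rightarrow> real"
  defines "E \<equiv> \<lambda>\<tau>. exp (LINT s:{t0..\<tau>}|lebesgue. c s - (b s)\<^sup>2 / a s)"
  assumes le: "t0 \<le> T"
    and ca: "continuous_on {t0..T} a" and cb: "continuous_on {t0..T} b"
    and cc: "continuous_on {t0..T} c" and cd: "continuous_on {t0..T} d"
    and a_nonpos: "\<And>t. t \<in> {t0..T} \<Longrightarrow> a t \<le> 0"
    and a_neg: "AE t in lebesgue. t \<in> {t0..T} \<longrightarrow> a t < 0"
    and int: "set_integrable lebesgue {t0..T} (\<lambda>t. (b t)\<^sup>2 / a t)"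
    and y: "\<And>t. t \<in> {t0..T} \<Longrightarrow>
      (y has_real_derivative - a t * y t ^ 3 - b t * y t ^ 2 - c t * y t - d t) (at t within {t0..T})"
    and y_nonneg: "\<And>t. t \<in> {t0..T} \<Longrightarrow> y t \<ge> 0"
  shows "y t0 \<le> E T * y T + (LINT \<tau>:{t0..T}|lebesgue. E \<tau> * d \<tau>)"
proof -
  define e where "e n = 1 / real (Suc n)" for n
  have e: "e n > 0" "e n \<le> 1" for n by (auto simp: e_def)
  have e_lim: "e \<longlonglongrightarrow> 0" unfolding e_def by (rule LIMSEQ_Suc[OF lim_1_over_n])
  have cy: "continuous_on {t0..T} y" by (rule DERIV_continuous_on[OF y])
  then have "bounded (y ` {t0..T})"
    by (intro compact_imp_bounded compact_continuous_image) auto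
  then obtain N where N: "\<And>t. t \<in> {t0..T} \<Longrightarrow> \<bar>y t\<bar> \<le> N"
    unfolding bounded_iff by (metis imageI real_norm_def)
  have N0: "N \<ge> 0" using N[of t0] le by auto
  define g where "g n s = c s - (b s)\<^sup>2 / (a s - e n)" for n s
  define G where "G n t = integral {t0..t} (g n)" for n t
  define f where "f n t = exp (G n t) * (d t + e n * N ^ 3)" for n t
  have ne: "a s - e n < 0" if "s \<in> {t0..T}" for s n using a_nonpos[OF that] e(1)[of n] by linarith
  have cg: "continuous_on {t0..T} (g n)" for n
    unfolding g_def by (intro continuous_intros ca cb cc) (use ne in force)
  have cG: "continuous_on {t0..T} (G n)" for n
    unfolding G_def by (intro indefinite_integral_continuous_1 integrable_continuous_real cg)
  have cf: "continuous_on {t0..T} (f n)" for n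
    unfolding f_def by (intro continuous_intros cG cd)

  have approx: "y t0 \<le> exp (G n T) * y T + integral {t0..T} (f n)" for n
  proof -
    define h where "h t = exp (G n t) * y t + integral {t0..t} (f n)" for t
    have "h t0 \<le> h T"
    proof (rule DERIV_nonneg_imp_increasing_open[OF le, where f = h])
      show "continuous_on {t0..T} h" unfolding h_def
        by (intro continuous_intros cG cy indefinite_integral_continuous_1 integrable_continuous_real cf)
    next
      fix t assume t: "t0 < t" "t < T"
      then have tI: "t \<in> {t0..T}" and at: "at t within {t0..T} = at t"
        by (auto intro!: at_within_Icc_at)
      have dG: "(G n has_real_derivative g n t) (at t)"
        using integral_has_real_derivative[OF cg tI] at by (simp add: G_def[abs_def])
      have df: "((\<lambda>t. integral {t0..t} (f n)) has_real_derivative f n t) (at t)"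
        using integral_has_real_derivative[OF cf tI] at by simp
      let ?y' = "- a t * y t ^ 3 - b t * y t ^ 2 - c t * y t - d t"
      have "(h has_real_derivative exp (G n t) * (g n t * y t + ?y' + d t + e n * N ^ 3)) (at t)"
        unfolding h_def using y[OF tI] dG df at
        by (auto intro!: derivative_eq_intros simp: f_def algebra_simps)
      moreover have "0 \<le> g n t * y t + ?y' + d t + e n * N ^ 3"
      proof -
        \<comment> \<open>The terms are regrouped as a cubic with leading coefficient \<open>A\<close>; trading \<open>a\<close> for \<open>A\<close> costs \<open>e n * y t ^ 3\<close>,
          which the summand \<open>e n * N ^ 3\<close> of \<open>f\<close> was introduced to absorb.\<close>
        define A where "A = a t - e n"
        have at_eq: "a t = A + e n" by (simp add: A_def)
        have A: "A < 0" using ne[OF tI] by (simp add: A_def)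
        have sq: "0 \<le> (A * y t)\<^sup>2 + (A * y t) * b t + (b t)\<^sup>2"
        proof -
          have "(A * y t)\<^sup>2 + (A * y t) * b t + (b t)\<^sup>2 = (A * y t + b t / 2)\<^sup>2 + 3 / 4 * (b t)\<^sup>2"
            by (simp add: power2_eq_square field_simps)
          then show ?thesis by simp
        qed
        have "- A * (y t)\<^sup>2 - b t * y t - (b t)\<^sup>2 / A = ((A * y t)\<^sup>2 + (A * y t) * b t + (b t)\<^sup>2) / (- A)"
          using A by (simp add: field_simps power2_eq_square)
        also have "\<dots> \<ge> 0" using sq A by (intro divide_nonneg_pos) auto
        finally have "0 \<le> y t * (- A * (y t)\<^sup>2 - b t * y t - (b t)\<^sup>2 / A)"
          using y_nonneg[OF tI] by (intro mult_nonneg_nonneg)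
        moreover have "y t ^ 3 \<le> N ^ 3" using N[OF tI] y_nonneg[OF tI] by (intro power_mono) auto
        then have "e n * y t ^ 3 \<le> e n * N ^ 3" using e(1)[of n] by simp
        moreover have "g n t * y t + ?y' + d t
            = y t * (- A * (y t)\<^sup>2 - b t * y t - (b t)\<^sup>2 / A) - e n * y t ^ 3"
          by (simp add: g_def at_eq algebra_simps power2_eq_square power3_eq_cube)
        ultimately show ?thesis by linarith
      qed
      ultimately show "\<exists>h'. (h has_real_derivative h') (at t) \<and> 0 \<le> h'" by (blast intro: mult_nonneg_nonneg exp_ge_zero)
    qed
    then show ?thesis by (simp add: h_def G_def)
  qed

  define w where "w s = indicator {t0..T} s *\<^sub>R (\<bar>c s\<bar> + \<bar>(b s)\<^sup>2 / a s\<bar>)" for s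
  have int_c: "set_integrable lebesgue {t0..T} c" by (rule absolutely_integrable_continuous_real[OF cc])
  have w: "integrable lebesgue w"
    using set_integral_add(1)[OF set_integrable_abs[OF int_c] set_integrable_abs[OF int]]
    by (simp add: set_integrable_def w_def[abs_def])
  have g_le: "AE s in lebesgue. norm (indicator {t0..t} s *\<^sub>R g n s) \<le> w s" if "t \<in> {t0..T}" for n t
    using a_neg
  proof eventually_elim
    case (elim s)
    have "\<bar>g n s\<bar> \<le> \<bar>c s\<bar> + \<bar>(b s)\<^sup>2 / a s\<bar>" if "s \<in> {t0..T}"
    proof -
      have "\<bar>(b s)\<^sup>2 / (a s - e n)\<bar> \<le> \<bar>(b s)\<^sup>2 / a s\<bar>"
        unfolding abs_divide using elim that e(1)[of n] by (intro divide_left_mono) (auto intro: mult_pos_neg)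
      then show ?thesis unfolding g_def by linarith
    qed
    then show ?case using \<open>t \<in> {t0..T}\<close> by (auto simp: w_def indicator_def)
  qed
  have g_meas: "(\<lambda>s. indicator {t0..t} s *\<^sub>R g n s) \<in> borel_measurable lebesgue"
    if "t \<in> {t0..T}" for n t
    using absolutely_integrable_continuous_real[OF continuous_on_subset[OF cg, of "{t0..t}" n]] that
    by (auto simp: set_integrable_def)
  have G_eq: "G n t = (LINT s|lebesgue. indicator {t0..t} s *\<^sub>R g n s)" if "t \<in> {t0..T}" for n t
    unfolding G_def using that
    by (subst set_lebesgue_integral_eq_integral(2)[symmetric])
       (auto intro!: absolutely_integrable_continuous_real continuous_on_subset[OF cg] simp: set_lebesgue_integral_def)
  have G_lim: "(\<lambda>n. exp (G n t)) \<longlonglongrightarrow> E t" if t: "t \<in> {t0..T}" for t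
    unfolding E_def set_lebesgue_integral_def G_eq[OF t]
  proof (intro tendsto_exp integral_dominated_convergence[OF _ g_meas[OF t] w _ g_le[OF t]])
    have "set_integrable lebesgue {t0..T} (\<lambda>s. c s - (b s)\<^sup>2 / a s)"
      by (intro set_integral_diff int_c int)
    then have "set_integrable lebesgue {t0..t} (\<lambda>s. c s - (b s)\<^sup>2 / a s)"
      by (rule set_integrable_subset) (use t in auto)
    then show "(\<lambda>s. indicator {t0..t} s *\<^sub>R (c s - (b s)\<^sup>2 / a s)) \<in> borel_measurable lebesgue"
      by (auto simp: set_integrable_def)
    show "AE s in lebesgue. (\<lambda>n. indicator {t0..t} s *\<^sub>R g n s)
        \<longlonglongrightarrow> indicator {t0..t} s *\<^sub>R (c s - (b s)\<^sup>2 / a s)"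
      using a_neg
    proof eventually_elim
      case (elim s)
      show ?case
      proof (cases "s \<in> {t0..t}")
        case True
        with elim t have "a s \<noteq> 0" by auto
        then have "(\<lambda>n. g n s) \<longlonglongrightarrow> c s - (b s)\<^sup>2 / (a s - 0)"
          unfolding g_def by (intro tendsto_intros e_lim) auto
        then show ?thesis using True by simp
      qed simp
    qed
  qed
  have G_bd: "exp (G n t) \<le> exp (integral\<^sup>L lebesgue w)" if t: "t \<in> {t0..T}" for n t
  proof -
    have "G n t \<le> norm (LINT s|lebesgue. indicator {t0..t} s *\<^sub>R g n s)" using G_eq[OF t] by simp
    also have "\<dots> \<le> integral\<^sup>L lebesgue w"
      by (intro order_trans[OF integral_norm_bound] integral_mono_AE'[OF w g_le[OF t]] AE_I2)
         (auto simp: w_def)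
    finally show ?thesis by simp
  qed
  have f_eq: "integral {t0..T} (f n) = (LINT s|lebesgue. indicator {t0..T} s *\<^sub>R f n s)" for n
    by (subst set_lebesgue_integral_eq_integral(2)[symmetric])
       (auto intro!: absolutely_integrable_continuous_real cf simp: set_lebesgue_integral_def)
  have f_meas: "(\<lambda>s. indicator {t0..T} s *\<^sub>R f n s) \<in> borel_measurable lebesgue" for n
    using absolutely_integrable_continuous_real[OF cf[of n]] by (auto simp: set_integrable_def)
  have f_lim: "(\<lambda>n. indicator {t0..T} s *\<^sub>R f n s) \<longlonglongrightarrow> indicator {t0..T} s *\<^sub>R (E s * d s)" for s
  proof (cases "s \<in> {t0..T}")
    case True
    have "(\<lambda>n. f n s) \<longlonglongrightarrow> E s * (d s + 0 * N ^ 3)"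
      unfolding f_def by (intro tendsto_intros G_lim True e_lim)
    then show ?thesis using True by simp
  qed simp
  let ?v = "\<lambda>s. indicator {t0..T} s *\<^sub>R (exp (integral\<^sup>L lebesgue w) * (\<bar>d s\<bar> + N ^ 3))"
  have v: "integrable lebesgue ?v"
    unfolding set_integrable_def[symmetric]
    by (intro absolutely_integrable_continuous_real continuous_intros cd)
  have "(\<lambda>n. integral {t0..T} (f n)) \<longlonglongrightarrow> (LINT \<tau>:{t0..T}|lebesgue. E \<tau> * d \<tau>)"
    unfolding f_eq set_lebesgue_integral_def
  proof (rule integral_dominated_convergence[OF _ f_meas v])
    show "(\<lambda>s. indicator {t0..T} s *\<^sub>R (E s * d s)) \<in> borel_measurable lebesgue"
      by (rule borel_measurable_LIMSEQ_real[OF f_lim f_meas])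
    show "AE s in lebesgue. norm (indicator {t0..T} s *\<^sub>R f n s) \<le> ?v s" for n
    proof (intro AE_I2)
      fix s
      have "\<bar>f n s\<bar> \<le> exp (integral\<^sup>L lebesgue w) * (\<bar>d s\<bar> + N ^ 3)" if "s \<in> {t0..T}"
      proof -
        have "\<bar>d s + e n * N ^ 3\<bar> \<le> \<bar>d s\<bar> + e n * N ^ 3" using e(1)[of n] N0
          by (intro order_trans[OF abs_triangle_ineq]) (simp add: abs_mult)
        also have "\<dots> \<le> \<bar>d s\<bar> + N ^ 3" using e[of n] N0 by (simp add: mult_left_le_one_le)
        finally show ?thesis
          unfolding f_def abs_mult by (intro mult_mono) (use G_bd[OF that] in auto)
      qed
      then show "norm (indicator {t0..T} s *\<^sub>R f n s) \<le> ?v s" by (auto simp: indicator_def)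
    qed
  qed (use f_lim in auto)
  then have "(\<lambda>n. exp (G n T) * y T + integral {t0..T} (f n))
      \<longlonglongrightarrow> E T * y T + (LINT \<tau>:{t0..T}|lebesgue. E \<tau> * d \<tau>)"
    using le by (intro tendsto_intros G_lim) auto
  then show ?thesis by (rule LIMSEQ_le_const) (use approx in blast)
qed


text \<open>
  A closed set containing almost every point of an open interval contains all of it, and continuity
  extends the sign to the endpoints. The lower bound needs the sign everywhere, since it makes
  \<open>a - \<epsilon>\<close> vanish nowhere.
\<close>
lemma nonpos_on_Icc_if_AE_neg:
  fixes a :: "real \<Rightarrow> real"
  assumes "t0 < T" and cont: "continuous_on {t0..T} a"
    and neg: "AE t in lebesgue. t \<in> {t0..T} \<longrightarrow> a t < 0" and t: "t \<in> {t0..T}"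
  shows "a t \<le> 0"
proof -
  have "x \<in> {t \<in> {t0..T}. a t \<le> 0}" if x: "x \<in> {t0<..<T}" for x
  proof (rule mem_closed_if_AE_lebesgue_open[OF _ _ _ x])
    show "closed {t \<in> {t0..T}. a t \<le> 0}"
      by (intro continuous_on_closed_Collect_le cont continuous_intros)
    show "AE x\<in>{t0<..<T} in lebesgue. x \<in> {t \<in> {t0..T}. a t \<le> 0}"
      using neg by eventually_elim auto
  qed simp
  moreover have "closure {t0<..<T} = {t0..T}" using \<open>t0 < T\<close> by simp
  ultimately show ?thesis
    using continuous_le_on_closure[of "{t0<..<T}" a t 0] cont t by auto
qed

section \<open>The truncated equation and its Poincare map\<close>

text \<open>
  The truncation \<open>q\<close> does not increase distances, and the difference quotient of the cubic is
  \<open>- (a (u\<^sup>2 + u v + v\<^sup>2) + b (u + v) + c)\<close>, which is bounded for \<open>u, v\<close> in \<open>[- N, N]\<close>.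
\<close>
lemma truncated_cubic_lipschitz:
  fixes a b c d N x y :: real
  defines "q \<equiv> \<lambda>x. max (- N) (min N x)"
  defines "f \<equiv> \<lambda>x. - a * x ^ 3 - b * x ^ 2 - c * x - d"
  assumes N: "N \<ge> 0" and "\<bar>a\<bar> \<le> A" "\<bar>b\<bar> \<le> B" "\<bar>c\<bar> \<le> C"
  shows "\<bar>f (q x) - f (q y)\<bar> \<le> (A * (3 * N\<^sup>2) + B * (2 * N) + C) * \<bar>x - y\<bar>"
proof -
  define u v where "u = q x" and "v = q y"
  have u: "\<bar>u\<bar> \<le> N" and v: "\<bar>v\<bar> \<le> N" using N by (auto simp: u_def v_def q_def)
  have uv: "\<bar>u - v\<bar> \<le> \<bar>x - y\<bar>" using N by (auto simp: u_def v_def q_def)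
  have nonneg: "A \<ge> 0" "B \<ge> 0" "C \<ge> 0" using assms(4-6) by auto
  have "\<bar>u\<^sup>2 + u * v + v\<^sup>2\<bar> \<le> 3 * N\<^sup>2"
  proof -
    have "\<bar>u * u\<bar> \<le> N * N" "\<bar>u * v\<bar> \<le> N * N" "\<bar>v * v\<bar> \<le> N * N"
      unfolding abs_mult by (intro mult_mono u v N abs_ge_zero)+
    then show ?thesis unfolding power2_eq_square by linarith
  qed
  then have "\<bar>a * (u\<^sup>2 + u * v + v\<^sup>2)\<bar> \<le> A * (3 * N\<^sup>2)"
    unfolding abs_mult by (intro mult_mono assms nonneg) auto
  moreover have "\<bar>b * (u + v)\<bar> \<le> B * (2 * N)"
    unfolding abs_mult by (intro mult_mono assms nonneg) (use u v in auto)
  ultimately have slope: "\<bar>a * (u\<^sup>2 + u * v + v\<^sup>2) + b * (u + v) + c\<bar> \<le> A * (3 * N\<^sup>2) + B * (2 * N) + C"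
    using \<open>\<bar>c\<bar> \<le> C\<close> by linarith
  have "f u - f v = - ((a * (u\<^sup>2 + u * v + v\<^sup>2) + b * (u + v) + c) * (u - v))"
    by (simp add: f_def power2_eq_square power3_eq_cube algebra_simps)
  then have "\<bar>f u - f v\<bar> = \<bar>a * (u\<^sup>2 + u * v + v\<^sup>2) + b * (u + v) + c\<bar> * \<bar>u - v\<bar>"
    by (simp add: abs_mult)
  also have "\<dots> \<le> (A * (3 * N\<^sup>2) + B * (2 * N) + C) * \<bar>x - y\<bar>"
    using slope uv by (intro mult_mono) (use nonneg N in auto)
  finally show ?thesis by (simp add: u_def v_def)
qed

lemma continuous_on_Icc_bounded:
  fixes g :: "real \<Rightarrow> real"
  assumes "continuous_on {t0..T} g"
  obtains M where "M > 0" "\<And>t. t \<in> {t0..T} \<Longrightarrow> \<bar>g t\<bar> \<le> M"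
proof -
  have "bounded (g ` {t0..T})" by (intro compact_imp_bounded compact_continuous_image assms) auto
  then obtain M where "M > 0" "\<forall>x\<in>g ` {t0..T}. norm x \<le> M" unfolding bounded_pos by blast
  then show thesis using that[of M] by auto
qed

theorem theorem5p3:
  fixes t0 T :: real and a b c d :: "real \<Rightarrow> real"
  assumes "t0 < T"
    and "continuous_on {t0..T} a" "continuous_on {t0..T} b"
    and "continuous_on {t0..T} c" "continuous_on {t0..T} d"
    and "AE t in lebesgue_on {t0..T}. a t < 0"
    and "set_integrable lebesgue {t0..T} (\<lambda>t. (b t)\<^sup>2 / a t)"
    and "\<forall>t\<in>{t0..T}.
      (LINT \<tau>:{t0..t}|lebesgue. exp (LINT s:{t0..\<tau>}|lebesgue. c s - (b s)\<^sup>2 / a s) * d \<tau>) \<le> 0"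
    and "\<exists>\<eta>. abel_ineq_solution_on a b c d {t0..T} \<eta> \<and> \<eta> t0 \<ge> \<eta> T \<and> \<eta> T > 0"
  shows "\<exists>y. abel_closed_solution_on a b c d t0 T y \<and> (\<forall>t\<in>{t0..T}. y t \<ge> 0)"
proof -
  obtain \<eta> where \<eta>: "abel_ineq_solution_on a b c d {t0..T} \<eta>" and \<eta>T: "\<eta> T \<le> \<eta> t0" "\<eta> T > 0"
    using assms(9) by blast
  have a_neg: "AE t in lebesgue. t \<in> {t0..T} \<longrightarrow> a t < 0"
    using assms(6) by (simp add: AE_restrict_space_iff)
  have a_nonpos: "a t \<le> 0" if "t \<in> {t0..T}" for t
    using nonpos_on_Icc_if_AE_neg[OF assms(1,2) a_neg that] .
  have c\<eta>: "continuous_on {t0..T} \<eta>"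
    unfolding continuous_on_eq_continuous_within
    using \<eta> DERIV_continuous unfolding abel_ineq_solution_on_def by blast
  obtain N where N: "N > 0" "\<And>t. t \<in> {t0..T} \<Longrightarrow> \<bar>\<eta> t\<bar> \<le> N"
    using continuous_on_Icc_bounded[OF c\<eta>] by blast
  obtain A where A: "A > 0" "\<And>t. t \<in> {t0..T} \<Longrightarrow> \<bar>a t\<bar> \<le> A"
    using continuous_on_Icc_bounded[OF assms(2)] by blast
  obtain B where B: "B > 0" "\<And>t. t \<in> {t0..T} \<Longrightarrow> \<bar>b t\<bar> \<le> B"
    using continuous_on_Icc_bounded[OF assms(3)] by blast
  obtain C where C: "C > 0" "\<And>t. t \<in> {t0..T} \<Longrightarrow> \<bar>c t\<bar> \<le> C"
    using continuous_on_Icc_bounded[OF assms(4)] by blast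
  define f where "f t x = - a t * x ^ 3 - b t * x ^ 2 - c t * x - d t" for t x
  \<comment> \<open>The bound \<open>N\<close> covers negative values of \<open>\<eta>\<close> as well, so that \<open>\<eta>\<close> is a supersolution of the
    truncated equation too.\<close>
  define q where "q x = max (- N) (min N x)" for x
  define F where "F t x = f t (q x)" for t x
  define L where "L = A * (3 * N\<^sup>2) + B * (2 * N) + C"
  have L0: "L \<ge> 0" using A B C N by (simp add: L_def)
  have F_eq: "F t x = f t x" if "\<bar>x\<bar> \<le> N" for t x
    using that by (auto simp: F_def q_def)
  have lip: "\<bar>F t x - F t y\<bar> \<le> L * \<bar>x - y\<bar>" if "t \<in> {t0..T}" for t x y
    unfolding F_def f_def q_def L_def
    using N(1) by (intro truncated_cubic_lipschitz A(2) B(2) C(2) that) auto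
  have lip': "F t x - F t y \<le> L * (x - y)" if "t \<in> {t0..T}" "y \<le> x" for t x y
    using lip[OF that(1), of x y] that(2) by simp
  have "continuous_on ({t0..T} \<times> UNIV) (\<lambda>p. F (fst p) (snd p))"
    unfolding F_def f_def q_def
    by (intro continuous_intros continuous_on_compose2[OF assms(2)] continuous_on_compose2[OF assms(3)]
        continuous_on_compose2[OF assms(4)] continuous_on_compose2[OF assms(5)]) auto
  then have cF: "continuous_on ({t0..T} \<times> UNIV) (\<lambda>(t, x). F t x)" by (simp add: case_prod_unfold)
  have "\<forall>s. \<exists>y. y t0 = s \<and> (\<forall>t\<in>{t0..T}. (y has_real_derivative F t (y t)) (at t within {t0..T}))"
    using lipschitz_ivp_exists[OF _ cF lip L0] assms(1) by simp
  then obtain Y where Y0: "\<And>s. Y s t0 = s"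
    and Y: "\<And>s t. t \<in> {t0..T} \<Longrightarrow> (Y s has_real_derivative F t (Y s t)) (at t within {t0..T})"
    by metis
  have cY: "continuous_on {t0..T} (Y s)" for s by (rule DERIV_continuous_on[OF Y])
  define M where "M = exp (L * (T - t0))"
  have dep: "\<bar>Y s t - Y r t\<bar> \<le> M * \<bar>s - r\<bar>" if t: "t \<in> {t0..T}" for s r t
  proof -
    have "\<bar>Y s t - Y r t\<bar> \<le> exp (L * (t - t0)) * \<bar>s - r\<bar>"
      using lipschitz_dependence_on_initial_value[OF lip' Y[of _ s] Y[of _ r] t] by (simp add: Y0)
    also have "\<dots> \<le> M * \<bar>s - r\<bar>"
      unfolding M_def using t L0 by (intro mult_right_mono) (auto intro: mult_left_mono)
    finally show ?thesis .
  qed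
  have below: "Y s t \<le> \<eta> t" if s: "s \<le> \<eta> t0" and t: "t \<in> {t0..T}" for s t
  proof (rule supersolution_comparison[where F = F and L = L, OF lip' Y _ _ t])
    fix u assume u: "u \<in> {t0..T}"
    obtain e where "(\<eta> has_real_derivative e) (at u within {t0..T})"
      "e + a u * \<eta> u ^ 3 + b u * \<eta> u ^ 2 + c u * \<eta> u + d u \<ge> 0"
      using \<eta> u unfolding abel_ineq_solution_on_def by blast
    then show "\<exists>e. (\<eta> has_real_derivative e) (at u within {t0..T}) \<and> F u (\<eta> u) \<le> e"
      unfolding F_eq[OF N(2)[OF u]] f_def by (intro exI[of _ e]) auto
  qed (use s Y0 in auto)
  have pos: "Y s t > 0" if s: "0 < s" "s \<le> \<eta> t0" and t: "t \<in> {t0..T}" for s t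
  proof (rule ccontr)
    assume "\<not> Y s t > 0"
    let ?S = "{u \<in> {t0..t}. Y s u \<le> 0}"
    have "closed ?S"
      by (intro continuous_on_closed_Collect_le continuous_on_subset[OF cY] continuous_intros)
         (use t in auto)
    then have "compact ?S"
      by (auto simp: compact_eq_bounded_closed intro: bounded_subset[of "{t0..t}"])
    moreover have "t \<in> ?S" using \<open>\<not> Y s t > 0\<close> t by auto
    ultimately obtain \<tau> where \<tau>: "\<tau> \<in> ?S" and min: "\<And>u. u \<in> ?S \<Longrightarrow> \<tau> \<le> u"
      using compact_attains_inf[of ?S] by blast
    have \<tau>I: "\<tau> \<in> {t0..T}" using \<tau> t by auto
    have sub: "{t0..\<tau>} \<subseteq> {t0..T}" using \<tau>I by auto
    \<comment> \<open>The first time at which \<open>Y s\<close> is nonpositive is a zero: the intermediate value theorem finds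
      a zero no later than \<open>\<tau>\<close>, and minimality of \<open>\<tau>\<close> excludes earlier ones.\<close>
    obtain u where "t0 \<le> u" "u \<le> \<tau>" "Y s u = 0"
      using IVT2'[of "Y s" \<tau> 0 t0] \<tau> s(1) continuous_on_subset[OF cY sub] by (auto simp: Y0)
    then have zero: "Y s \<tau> = 0" using min[of u] \<tau> by auto
    have nonneg: "Y s v \<ge> 0" if "v \<in> {t0..\<tau>}" for v
      using min[of v] that \<tau> zero by (cases "v = \<tau>") force+
    have "Y s t0 \<le> exp (LINT s:{t0..\<tau>}|lebesgue. c s - (b s)\<^sup>2 / a s) * Y s \<tau> +
        (LINT x:{t0..\<tau>}|lebesgue. exp (LINT s:{t0..x}|lebesgue. c s - (b s)\<^sup>2 / a s) * d x)"
    proof (rule weighted_lower_bound)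
      show "AE t in lebesgue. t \<in> {t0..\<tau>} \<longrightarrow> a t < 0"
        using a_neg by eventually_elim (use sub in auto)
      show "set_integrable lebesgue {t0..\<tau>} (\<lambda>t. (b t)\<^sup>2 / a t)"
        by (rule set_integrable_subset[OF assms(7)]) (use sub in auto)
    next
      fix v assume v: "v \<in> {t0..\<tau>}"
      then have vI: "v \<in> {t0..T}" using sub by auto
      have "\<bar>Y s v\<bar> \<le> N"
        using nonneg[OF v] below[OF s(2) vI] N(2)[OF vI] by auto
      then show "(Y s has_real_derivative - a v * Y s v ^ 3 - b v * (Y s v)\<^sup>2 - c v * Y s v - d v)
          (at v within {t0..\<tau>})"
        using DERIV_subset[OF Y[OF vI, of s] sub] by (simp add: F_eq f_def)
    qed (use \<tau> nonneg a_nonpos sub assms(2-5) in \<open>auto intro: continuous_on_subset\<close>)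
    moreover have "(LINT x:{t0..\<tau>}|lebesgue. exp (LINT s:{t0..x}|lebesgue. c s - (b s)\<^sup>2 / a s) * d x) \<le> 0"
      using assms(8) \<tau>I by blast
    ultimately show False using s(1) by (simp add: zero Y0)
  qed
  have nonneg: "Y s t \<ge> 0" if s: "0 \<le> s" "s \<le> \<eta> t0" and t: "t \<in> {t0..T}" for s t
  proof (cases "s = 0")
    case True
    show ?thesis
    proof (rule ccontr)
      assume neg: "\<not> Y s t \<ge> 0"
      \<comment> \<open>The solution starting at \<open>r > 0\<close> is positive, but this \<open>r\<close> is small enough to keep it within
        \<open>- Y s t\<close> of the negative value \<open>Y s t\<close>.\<close>
      define r where "r = min (\<eta> t0) (- Y s t / M)"
      have r: "0 < r" "r \<le> \<eta> t0" using neg \<eta>T by (auto simp: r_def M_def field_simps)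
      have "M * r \<le> M * (- Y s t / M)" by (intro mult_left_mono) (auto simp: r_def M_def)
      also have "\<dots> = - Y s t" by (simp add: M_def)
      finally show False using dep[OF t, of r s] pos[OF r t] r True by simp
    qed
  qed (use pos[OF _ s(2) t] s in force)
  have "continuous_on {0..\<eta> T} (\<lambda>s. Y s T)"
  proof (rule lipschitz_on_continuous_on)
    show "M-lipschitz_on {0..\<eta> T} (\<lambda>s. Y s T)"
      using dep[of T] assms(1) by (intro lipschitz_onI) (auto simp: dist_real_def M_def)
  qed
  then have "continuous_on {0..\<eta> T} (\<lambda>s. Y s T - s)" by (intro continuous_intros)
  then obtain s where s: "0 \<le> s" "s \<le> \<eta> T" "Y s T - s = 0"
    using IVT2'[of "\<lambda>s. Y s T - s" "\<eta> T" 0 0] below[of "\<eta> T" T] nonneg[of 0 T] \<eta>T assms(1) by auto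
  then have s': "s \<le> \<eta> t0" using \<eta>T by simp
  have "(Y s has_real_derivative f t (Y s t)) (at t within {t0..T})" if t: "t \<in> {t0..T}" for t
  proof -
    have "\<bar>Y s t\<bar> \<le> N" using nonneg[OF s(1) s' t] below[OF s' t] N(2)[OF t] by auto
    then show ?thesis using Y[OF t, of s] by (simp add: F_eq)
  qed
  then have "abel_eq_solution_on a b c d {t0..T} (Y s)"
    unfolding abel_eq_solution_on_def by (fastforce simp: f_def)
  then have "abel_closed_solution_on a b c d t0 T (Y s)"
    using s(3) by (simp add: abel_closed_solution_on_def Y0)
  then show ?thesis using nonneg[OF s(1) s'] by blast
qed

end
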